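(* Let $V=V_0+V_1$ be a Lie superalgebra over a field $K$, and let $A=(\lambda_A,\rho_A)$ be a CIF set of $V$. Then $A$ is a CIF Lie sub-superalgebra (respectively CIF ideal) of $V$ if and only if $A^c=(\lambda_A,\lambda_A^c)$ and $A^L=(\rho_A^c,\rho_A)$ are CIF Lie sub-superalgebras (respectively CIF ideals) of $V$.
   Context: Complex numbers in the closed unit disk are written $\alpha e^{i2\pi\beta}$ with $\alpha,\beta\in[0,1]$ and are handled through the pair $(\alpha,\beta)$: $\alpha e^{i2\pi\beta}\le\gamma e^{i2\pi\delta}$ means $\alpha\le\gamma$ and $\beta\le\delta$. The symbols $\wedge$ (min), $\vee$ (max), $\sup$, $\inf$ are taken componentwise on such pairs. The value $1$ stands for $1e^{i2\pi\cdot 1}$ and $0$ for $0e^{i2\pi\cdot 0}$. A complex intuitionistic fuzzy (CIF) set on a nonempty set $X$ is a pair $A=(\lambda_A,\rho_A)$ of functions $\lambda_A(x)=r_A(x)e^{i2\pi\omega_A(x)}$, $\rho_A(x)=\hat r_A(x)e^{i2\pi\hat\omega_A(x)}$ with $r_A,\omega_A,\hat r_A,\hat\omega_A:X\to[0,1]$ and $r_A(x)+\hat r_A(x)\le 1$ for all $x$. For such $A$, put $\lambda_A^c(x)=(1-r_A(x))e^{i2\pi(1-\omega_A(x))}$ and $\rho_A^c(x)=(1-\hat r_A(x))e^{i2\pi(1-\hat\omega_A(x))}$; then $A^c=(\lambda_A,\lambda_A^c)$ and $A^L=(\rho_A^c,\rho_A)$. A CIF set $A$ on a $K$-vector space $V$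 is a CIF vector subspace of $V$ if for all $x,y\in V$, $\alpha\in K$: $\lambda_A(x+y)\ge\lambda_A(x)\wedge\lambda_A(y)$, $\rho_A(x+y)\le\rho_A(x)\vee\rho_A(y)$, $\lambda_A(\alpha x)\ge\lambda_A(x)$, $\rho_A(\alpha x)\le\rho_A(x)$; moreover it is always assumed that $\lambda_A(0)=1$ and $\rho_A(0)=0$. A Lie superalgebra over $K$ is a $\mathbb{Z}_2$-graded vector space $V=V_0+V_1$ (direct sum) with a bilinear bracket $[\,,]:V\times V\to V$ such that $[V_i,V_j]\subseteq V_{i+j}$; $[x,y]=-(-1)^{|x||y|}[y,x]$; and $[x,[y,z]]-(-1)^{|x||y|}[y,[x,z]]=[[x,y],z]$ for homogeneous elements. Given CIF vector subspaces $A_j$ of $V_j$ ($j=0,1$), let $\mathfrak a_j$ be the extension of $A_j$ to $V$: $\lambda_{\mathfrak a_j}=\lambda_{A_j}$, $\rho_{\mathfrak a_j}=\rho_{A_j}$ on $V_j$, and $\lambda_{\mathfrak a_j}=0$, $\rho_{\mathfrak a_j}=1$ off $V_j$. Then $A_0\oplus A_1$ denotes the CIF set $\mathfrak a_0+\mathfrak a_1$ on $V$ given by $\lambda(x)=\sup_{x=a+b}\{\lambda_{\mathfrak a_0}(a)\wedge\lambda_{\mathfrak a_1}(b)\}$, $\rho(x)=\inf_{x=a+b}\{\rho_{\mathfrak a_0}(a)\vee\rho_{\mathfrak a_1}(b)\}$. A CIF vector subspace $A$ of $V$ is $\mathbb{Z}_2$-graded if $A=A_0\oplus A_1$ for some such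 $A_0,A_1$. A CIF set $A$ of $V$ is a CIF Lie sub-superalgebra if it is a $\mathbb{Z}_2$-graded CIF vector subspace and $\lambda_A([x,y])\ge\lambda_A(x)\wedge\lambda_A(y)$, $\rho_A([x,y])\le\rho_A(x)\vee\rho_A(y)$ for all $x,y\in V$. It is a CIF ideal if it is a $\mathbb{Z}_2$-graded CIF vector subspace and $\lambda_A([x,y])\ge\lambda_A(x)\vee\lambda_A(y)$, $\rho_A([x,y])\le\rho_A(x)\wedge\rho_A(y)$ for all $x,y\in V$. *)

theory Defs
  imports Complex_Main "HOL-Library.Product_Order" "HOL-Library.Z2"
begin

text \<open>
  A value $r e^{i 2 \pi \omega}$ of the closed unit disk is given by its pair $(r, \omega)$ of
  amplitude and phase parameters, both in $[0,1]$; pairs are not identified when they happen to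
  denote the same complex number.  The order and \<^const>\<open>inf\<close>, \<^const>\<open>sup\<close>, \<^const>\<open>Inf\<close>,
  \<^const>\<open>Sup\<close> on pairs are the componentwise ones of \<^theory>\<open>HOL-Library.Product_Order\<close>.
\<close>

type_synonym cval = "real \<times> real"

definition unit_cval :: "cval set" where
  "unit_cval = {0..1} \<times> {0..1}"

definition cval_one :: cval where
  "cval_one = (1, 1)"

definition cval_zero :: cval where
  "cval_zero = (0, 0)"

definition ccompl :: "cval \<Rightarrow> cval" where
  "ccompl z = (1 - fst z, 1 - snd z)"

text \<open>\<open>lam\<close> is the membership function, \<open>rho\<close> the non-membership function.\<close>

datatype 'v cif = CIF (lam: "'v \<Rightarrow> cval") (rho: "'v \<Rightarrow> cval")

text \<open>
  \<open>cif_set X A\<close>: \<open>A\<close> is a CIF set on \<open>X\<close>; its values outside \<open>X\<close> are irrelevant.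
  Only the amplitudes are constrained jointly.
\<close>

definition cif_set :: "'v set \<Rightarrow> 'v cif \<Rightarrow> bool" where
  "cif_set X A \<longleftrightarrow>
    (\<forall>x\<in>X. lam A x \<in> unit_cval \<and> rho A x \<in> unit_cval \<and> fst (lam A x) + fst (rho A x) \<le> 1)"

definition cif_c :: "'v cif \<Rightarrow> 'v cif" where
  "cif_c A = CIF (lam A) (\<lambda>x. ccompl (lam A x))"

definition cif_L :: "'v cif \<Rightarrow> 'v cif" where
  "cif_L A = CIF (\<lambda>x. ccompl (rho A x)) (rho A)"

text \<open>\<open>W\<close> is the carrier of the vector space: the whole type or a linear subspace of it.\<close>

definition cif_vector_subspace ::
    "('k \<Rightarrow> 'v \<Rightarrow> 'v::ab_group_add) \<Rightarrow> 'v set \<Rightarrow> 'v cif \<Rightarrow> bool" where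
  "cif_vector_subspace scale W A \<longleftrightarrow>
    cif_set W A \<and>
    (\<forall>x\<in>W. \<forall>y\<in>W. lam A (x + y) \<ge> inf (lam A x) (lam A y) \<and>
                   rho A (x + y) \<le> sup (rho A x) (rho A y)) \<and>
    (\<forall>x\<in>W. \<forall>a. lam A (scale a x) \<ge> lam A x \<and> rho A (scale a x) \<le> rho A x) \<and>
    lam A 0 = cval_one \<and> rho A 0 = cval_zero"

definition cif_extend :: "'v set \<Rightarrow> 'v cif \<Rightarrow> 'v cif" where
  "cif_extend W A =
    CIF (\<lambda>x. if x \<in> W then lam A x else cval_zero) (\<lambda>x. if x \<in> W then rho A x else cval_one)"

definition cif_plus :: "'v::ab_group_add cif \<Rightarrow> 'v cif \<Rightarrow> 'v cif" where
  "cif_plus A B =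
    CIF (\<lambda>x. Sup {inf (lam A a) (lam B b) | a b. x = a + b})
        (\<lambda>x. Inf {sup (rho A a) (rho B b) | a b. x = a + b})"

definition cif_dsum :: "(bit \<Rightarrow> 'v::ab_group_add set) \<Rightarrow> 'v cif \<Rightarrow> 'v cif \<Rightarrow> 'v cif" where
  "cif_dsum V A0 A1 = cif_plus (cif_extend (V 0) A0) (cif_extend (V 1) A1)"

definition graded_cif_vector_subspace ::
    "('k \<Rightarrow> 'v \<Rightarrow> 'v::ab_group_add) \<Rightarrow> (bit \<Rightarrow> 'v set) \<Rightarrow> 'v cif \<Rightarrow> bool" where
  "graded_cif_vector_subspace scale V A \<longleftrightarrow>
    cif_vector_subspace scale UNIV A \<and>
    (\<exists>A0 A1. cif_vector_subspace scale (V 0) A0 \<and> cif_vector_subspace scale (V 1) A1 \<and>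
             A = cif_dsum V A0 A1)"

text \<open>
  The underlying vector space is the whole type \<open>'v\<close>; \<open>V\<close> is its grading, indexed by
  \<^typ>\<open>bit\<close> as the two-element ring of degrees.
\<close>

locale lie_superalgebra = vector_space scale
  for scale :: "'k::field \<Rightarrow> 'v::ab_group_add \<Rightarrow> 'v" +
  fixes V :: "bit \<Rightarrow> 'v set"
    and bracket :: "'v \<Rightarrow> 'v \<Rightarrow> 'v"
  assumes subspace_V: "subspace (V i)"
    and V_inter: "V 0 \<inter> V 1 = {0}"
    and V_sum: "\<exists>a\<in>V 0. \<exists>b\<in>V 1. x = a + b"
    and linear_left: "Vector_Spaces.linear scale scale (\<lambda>x. bracket x y)"
    and linear_right: "Vector_Spaces.linear scale scale (\<lambda>y. bracket x y)"
    and bracket_degree: "x \<in> V i \<Longrightarrow> y \<in> V j \<Longrightarrow> bracket x y \<in> V (i + j)"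
    and bracket_skew: "x \<in> V i \<Longrightarrow> y \<in> V j \<Longrightarrow>
      bracket x y = - scale ((- 1) ^ (of_bit i * of_bit j)) (bracket y x)"
    and bracket_jacobi: "x \<in> V i \<Longrightarrow> y \<in> V j \<Longrightarrow> z \<in> V k \<Longrightarrow>
      bracket x (bracket y z)
        - scale ((- 1) ^ (of_bit i * of_bit j)) (bracket y (bracket x z))
      = bracket (bracket x y) z"

definition cif_lie_sub_superalgebra ::
    "('k \<Rightarrow> 'v \<Rightarrow> 'v::ab_group_add) \<Rightarrow> (bit \<Rightarrow> 'v set) \<Rightarrow> ('v \<Rightarrow> 'v \<Rightarrow> 'v) \<Rightarrow> 'v cif \<Rightarrow> bool" where
  "cif_lie_sub_superalgebra scale V bracket A \<longleftrightarrow>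
    graded_cif_vector_subspace scale V A \<and>
    (\<forall>x y. lam A (bracket x y) \<ge> inf (lam A x) (lam A y) \<and>
           rho A (bracket x y) \<le> sup (rho A x) (rho A y))"

definition cif_ideal ::
    "('k \<Rightarrow> 'v \<Rightarrow> 'v::ab_group_add) \<Rightarrow> (bit \<Rightarrow> 'v set) \<Rightarrow> ('v \<Rightarrow> 'v \<Rightarrow> 'v) \<Rightarrow> 'v cif \<Rightarrow> bool" where
  "cif_ideal scale V bracket A \<longleftrightarrow>
    graded_cif_vector_subspace scale V A \<and>
    (\<forall>x y. lam A (bracket x y) \<ge> sup (lam A x) (lam A y) \<and>
           rho A (bracket x y) \<le> inf (rho A x) (rho A y))"

end

(* The conditions on lam and on rho do not interact, except for the amplitude constraint, and those
   on rho are the ones on lam for the complement of rho.  For the grading this becomes visible once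
   A = A_0 \<oplus> A_1 is read off the unique decomposition x = a + b with a in V_0, b in V_1: it says
   that lam A (a + b) = lam A a \<and> lam A b and dually for rho.  Passing to A^c or A^L only repeats
   one of the two halves. *)
theory Submission
  imports Defs
begin

lemma unit_cval_iff: "z \<in> unit_cval \<longleftrightarrow> cval_zero \<le> z \<and> z \<le> cval_one"
  by (cases z) (auto simp: unit_cval_def cval_zero_def cval_one_def)

text \<open>As an order-reversing involution, \<open>ccompl\<close> exchanges \<open>inf\<close>
  with \<open>sup\<close> and \<open>cval_one\<close> with \<open>cval_zero\<close>. This turns each
  condition on \<open>rho\<close> into one of the same form as for \<open>lam\<close>.\<close>

lemma ccompl_ccompl [simp]: "ccompl (ccompl z) = z"
  by (simp add: ccompl_def)

lemma ccompl_le_iff: "ccompl x \<le> ccompl y \<longleftrightarrow> y \<le> x"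
  by (auto simp: ccompl_def less_eq_prod_def)

lemma ccompl_eq_iff: "ccompl x = ccompl y \<longleftrightarrow> x = y"
  by (metis ccompl_ccompl)

lemma ccompl_sup: "ccompl (sup x y) = inf (ccompl x) (ccompl y)"
  by (auto simp: ccompl_def prod_eq_iff sup_real_def inf_real_def)

lemma ccompl_inf: "ccompl (inf x y) = sup (ccompl x) (ccompl y)"
  by (auto simp: ccompl_def prod_eq_iff sup_real_def inf_real_def)

lemma ccompl_in_unit_cval: "ccompl z \<in> unit_cval \<longleftrightarrow> z \<in> unit_cval"
  by (cases z) (auto simp: ccompl_def unit_cval_def)

lemma ccompl_eq_one_iff: "ccompl z = cval_one \<longleftrightarrow> z = cval_zero"
  by (cases z) (auto simp: ccompl_def cval_one_def cval_zero_def)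

context lie_superalgebra
begin

lemma decomposition_unique:
  assumes "a \<in> V 0" "b \<in> V 1" "a' \<in> V 0" "b' \<in> V 1" "a + b = a' + b'"
  shows "a = a'" "b = b'"
proof -
  have eq: "a - a' = b' - b"
    using assms(5) by (simp add: algebra_simps)
  have "a - a' \<in> V 0" "b' - b \<in> V 1"
    using assms by (auto intro: subspace_diff subspace_V)
  then have "a - a' \<in> V 0 \<inter> V 1"
    by (simp add: eq)
  then have "a - a' = 0"
    by (simp add: V_inter)
  with eq show "a = a'" "b = b'"
    by simp_all
qed

text \<open>Among all decompositions of \<open>a + b\<close>, only the homogeneous one counts, and
  it is unique. Any other involves a default value of \<open>cif_extend\<close>, which can neither
  raise the supremum nor lower the infimum.\<close>

lemma cif_dsum_add:
  assumes A0: "cif_set (V 0) A0" and A1: "cif_set (V 1) A1"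
    and a: "a \<in> V 0" and b: "b \<in> V 1"
  shows "lam (cif_dsum V A0 A1) (a + b) = inf (lam A0 a) (lam A1 b)"
    and "rho (cif_dsum V A0 A1) (a + b) = sup (rho A0 a) (rho A1 b)"
proof -
  let ?B0 = "cif_extend (V 0) A0" and ?B1 = "cif_extend (V 1) A1"
  have unit: "cval_zero \<le> lam A0 u" "rho A0 u \<le> cval_one" if "u \<in> V 0" for u
    using A0 that by (auto simp: cif_set_def unit_cval_iff)
  have unit': "cval_zero \<le> lam A1 u" "rho A1 u \<le> cval_one" if "u \<in> V 1" for u
    using A1 that by (auto simp: cif_set_def unit_cval_iff)
  have le: "inf (lam ?B0 u) (lam ?B1 v) \<le> inf (lam A0 a) (lam A1 b) \<and>
            sup (rho A0 a) (rho A1 b) \<le> sup (rho ?B0 u) (rho ?B1 v)"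
    if uv: "a + b = u + v" for u v
  proof (cases "u \<in> V 0 \<and> v \<in> V 1")
    case True
    with decomposition_unique[OF a b _ _ uv] have "a = u" "b = v" by auto
    with True show ?thesis by (simp add: cif_extend_def)
  next
    case False
    \<comment> \<open>A component outside its homogeneous part has membership
      \<open>cval_zero\<close> and non-membership \<open>cval_one\<close>, the extreme values of the
      unit square.\<close>
    have "cval_zero \<le> inf (lam A0 a) (lam A1 b)" "sup (rho A0 a) (rho A1 b) \<le> cval_one"
      using unit[OF a] unit'[OF b] by auto
    moreover have "inf (lam ?B0 u) (lam ?B1 v) \<le> cval_zero" "cval_one \<le> sup (rho ?B0 u) (rho ?B1 v)"
      using False by (auto simp: cif_extend_def)
    ultimately show ?thesis by (meson order_trans)
  qed
  \<comment> \<open>The bound from \<open>le\<close> is attained at \<open>u = a\<close>,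
    \<open>v = b\<close>, so the supremum is a maximum; dually below for the infimum.\<close>
  have "Sup {inf (lam ?B0 u) (lam ?B1 v) | u v. a + b = u + v} = inf (lam A0 a) (lam A1 b)"
  proof (rule cSup_eq_maximum)
    show "inf (lam A0 a) (lam A1 b) \<in> {inf (lam ?B0 u) (lam ?B1 v) | u v. a + b = u + v}"
      using a b by (force simp: cif_extend_def)
  qed (use le in blast)
  then show "lam (cif_dsum V A0 A1) (a + b) = inf (lam A0 a) (lam A1 b)"
    by (simp add: cif_dsum_def cif_plus_def)
  have "Inf {sup (rho ?B0 u) (rho ?B1 v) | u v. a + b = u + v} = sup (rho A0 a) (rho A1 b)"
  proof (rule cInf_eq_minimum)
    show "sup (rho A0 a) (rho A1 b) \<in> {sup (rho ?B0 u) (rho ?B1 v) | u v. a + b = u + v}"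
      using a b by (force simp: cif_extend_def)
  qed (use le in blast)
  then show "rho (cif_dsum V A0 A1) (a + b) = sup (rho A0 a) (rho A1 b)"
    by (simp add: cif_dsum_def cif_plus_def)
qed

text \<open>This removes the existential over \<open>A0\<close> and \<open>A1\<close>: any such
  summands must agree with \<open>A\<close> on \<open>V 0\<close> and \<open>V 1\<close>, so
  \<open>A\<close> itself can serve as both.\<close>

lemma graded_cif_vector_subspace_iff_inf_sup:
  "graded_cif_vector_subspace scale V A \<longleftrightarrow>
    cif_vector_subspace scale UNIV A \<and>
    (\<forall>a\<in>V 0. \<forall>b\<in>V 1. lam A (a + b) = inf (lam A a) (lam A b) \<and>
                      rho A (a + b) = sup (rho A a) (rho A b))"
    (is "?L \<longleftrightarrow> ?A \<and> ?R")
proof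
  assume ?L
  then obtain A0 A1 where A: ?A
    and A0: "cif_vector_subspace scale (V 0) A0" and A1: "cif_vector_subspace scale (V 1) A1"
    and eq: "A = cif_dsum V A0 A1"
    by (auto simp: graded_cif_vector_subspace_def)
  have sets: "cif_set (V 0) A0" "cif_set (V 1) A1"
    and zero: "lam A0 0 = cval_one" "lam A1 0 = cval_one" "rho A0 0 = cval_zero" "rho A1 0 = cval_zero"
    using A0 A1 by (auto simp: cif_vector_subspace_def)
  have V0: "0 \<in> V i" for i
    by (rule subspace_0[OF subspace_V])
  note dsum = cif_dsum_add[OF sets, folded eq]
  have unit: "lam A0 u \<le> cval_one" "cval_zero \<le> rho A0 u" if "u \<in> V 0" for u
    using sets that by (auto simp: cif_set_def unit_cval_iff)
  have unit': "lam A1 u \<le> cval_one" "cval_zero \<le> rho A1 u" if "u \<in> V 1" for u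
    using sets that by (auto simp: cif_set_def unit_cval_iff)
  \<comment> \<open>Decompose \<open>a\<close> as \<open>a + 0\<close>: the values of
    \<open>A1\<close> at 0 are neutral for \<open>inf\<close> and \<open>sup\<close> on the unit
    square.\<close>
  have "lam A a = lam A0 a" "rho A a = rho A0 a" if "a \<in> V 0" for a
    using dsum[OF that V0] unit[OF that] by (simp_all add: zero inf_absorb1 sup_absorb1)
  moreover have "lam A b = lam A1 b" "rho A b = rho A1 b" if "b \<in> V 1" for b
    using dsum[OF V0 that] unit'[OF that] by (simp_all add: zero inf_absorb2 sup_absorb2)
  ultimately have ?R
    using dsum by simp
  with A show "?A \<and> ?R" ..
next
  assume R: "?A \<and> ?R"
  then have sub: "cif_vector_subspace scale (V i) A" and set: "cif_set (V i) A" for i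
    by (auto simp: cif_vector_subspace_def cif_set_def)
  \<comment> \<open>Both summands are taken to be \<open>A\<close>, since \<open>cif_extend\<close>
    discards its values off \<open>V i\<close>.\<close>
  have "lam A x = lam (cif_dsum V A A) x \<and> rho A x = rho (cif_dsum V A A) x" for x
  proof -
    obtain a b where "a \<in> V 0" "b \<in> V 1" "x = a + b"
      using V_sum by blast
    with R show ?thesis
      by (simp add: cif_dsum_add set)
  qed
  then have "A = cif_dsum V A A"
    by (intro cif.expand) auto
  with R sub show ?L
    unfolding graded_cif_vector_subspace_def by blast
qed

text \<open>The conditions that concern a single function, phrased for memberships;
  \<open>rho\<close> is tested through its complement, so one predicate covers both halves.\<close>

definition graded_membership :: "('v \<Rightarrow> cval) \<Rightarrow> bool" where
  "graded_membership f \<longleftrightarrow>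
    (\<forall>x. f x \<in> unit_cval) \<and>
    (\<forall>x y. inf (f x) (f y) \<le> f (x + y)) \<and>
    (\<forall>x a. f x \<le> f (scale a x)) \<and>
    f 0 = cval_one \<and>
    (\<forall>a\<in>V 0. \<forall>b\<in>V 1. f (a + b) = inf (f a) (f b))"

text \<open>The amplitude bound is the only condition linking \<open>lam\<close> and
  \<open>rho\<close>. With it supplied by the hypothesis, the remaining conditions split into two
  independent halves.\<close>

lemma graded_cif_vector_subspace_iff:
  assumes "cif_set UNIV A"
  shows "graded_cif_vector_subspace scale V A \<longleftrightarrow>
    graded_membership (lam A) \<and> graded_membership (\<lambda>x. ccompl (rho A x))"
  using assms
  unfolding graded_cif_vector_subspace_iff_inf_sup cif_vector_subspace_def graded_membership_def
    cif_set_def ccompl_in_unit_cval ccompl_le_iff ccompl_eq_iff ccompl_eq_one_iff ccompl_sup[symmetric]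
  by blast

lemma cif_lie_sub_superalgebra_iff:
  assumes "cif_set UNIV A"
  shows "cif_lie_sub_superalgebra scale V bracket A \<longleftrightarrow>
    (graded_membership (lam A) \<and>
      (\<forall>x y. inf (lam A x) (lam A y) \<le> lam A (bracket x y))) \<and>
    (graded_membership (\<lambda>x. ccompl (rho A x)) \<and>
      (\<forall>x y. inf (ccompl (rho A x)) (ccompl (rho A y)) \<le> ccompl (rho A (bracket x y))))"
  unfolding cif_lie_sub_superalgebra_def graded_cif_vector_subspace_iff[OF assms]
    ccompl_sup[symmetric] ccompl_le_iff
  by blast

text \<open>Here the bracket condition on \<open>rho\<close> has \<open>inf\<close> as its bound, so
  complementing yields \<open>sup\<close>, matching the condition on \<open>lam\<close>.\<close>

lemma cif_ideal_iff:
  assumes "cif_set UNIV A"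
  shows "cif_ideal scale V bracket A \<longleftrightarrow>
    (graded_membership (lam A) \<and>
      (\<forall>x y. sup (lam A x) (lam A y) \<le> lam A (bracket x y))) \<and>
    (graded_membership (\<lambda>x. ccompl (rho A x)) \<and>
      (\<forall>x y. sup (ccompl (rho A x)) (ccompl (rho A y)) \<le> ccompl (rho A (bracket x y))))"
  unfolding cif_ideal_def graded_cif_vector_subspace_iff[OF assms]
    ccompl_inf[symmetric] ccompl_le_iff
  by blast

end

text \<open>The amplitudes of a value and its complement add up to exactly 1.\<close>

lemma cif_set_cif_c: "cif_set W A \<Longrightarrow> cif_set W (cif_c A)"
  by (auto simp: cif_set_def cif_c_def ccompl_in_unit_cval) (simp add: ccompl_def)

lemma cif_set_cif_L: "cif_set W A \<Longrightarrow> cif_set W (cif_L A)"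
  by (auto simp: cif_set_def cif_L_def ccompl_in_unit_cval) (simp add: ccompl_def)

theorem theorem3p9:
  fixes scale :: "'k::field \<Rightarrow> 'v::ab_group_add \<Rightarrow> 'v"
    and V :: "bit \<Rightarrow> 'v set"
    and bracket :: "'v \<Rightarrow> 'v \<Rightarrow> 'v"
    and A :: "'v cif"
  assumes "lie_superalgebra scale V bracket"
    and "cif_set UNIV A"
  shows "(cif_lie_sub_superalgebra scale V bracket A \<longleftrightarrow>
           cif_lie_sub_superalgebra scale V bracket (cif_c A) \<and>
           cif_lie_sub_superalgebra scale V bracket (cif_L A)) \<and>
         (cif_ideal scale V bracket A \<longleftrightarrow>
           cif_ideal scale V bracket (cif_c A) \<and>
           cif_ideal scale V bracket (cif_L A))"
proof -
  interpret lie_superalgebra scale V bracket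
    by fact
  note sets = assms(2) cif_set_cif_c[OF assms(2)] cif_set_cif_L[OF assms(2)]
  show ?thesis
    \<comment> \<open>For \<open>cif_c A\<close> the second half involves a double complement of
      \<open>lam A\<close>, which cancels, leaving the \<open>lam\<close> half twice. For
      \<open>cif_L A\<close> both halves are the one for the complement of
      \<open>rho A\<close>.\<close>
    unfolding sets[THEN cif_lie_sub_superalgebra_iff] sets[THEN cif_ideal_iff]
    by (simp add: cif_c_def cif_L_def)
qed

end
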